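(* Let $\sigma>0$, let $v_1,\dots,v_N>0$ be arbitrary spectral variances, and for each noise level $q>0$ let $$\gamma_i=\frac{\sigma^2(v_i+q^2)}{\sigma^2+\mu_i q^2},\qquad i=1,\dots,N,$$ be the mode variances of the propagated Gaussian reference $p_{\mathrm{ref}}=\mathcal{N}\big(\boldsymbol{0},\,\boldsymbol{U}\,\mathrm{diag}(\gamma_1,\dots,\gamma_N)\,\boldsymbol{U}^\top\big)$ at noise level $q$. Then, as the terminal noise level $q\to\infty$, $$\gamma_i\longrightarrow\frac{\sigma^2}{\mu_i}\qquad\text{for every } i,$$ so the limit does not depend on the fitted spectral variances $v_i$, and the propagated reference converges to $\mathcal{N}(\boldsymbol{0},\sigma^2\boldsymbol{L}_\delta^{-1})$.
   Context: Graph setting: $\boldsymbol{L}$ is the symmetric normalized Laplacian of a fixed undirected nonnegatively weighted graph on $N$ nodes, with eigendecomposition $\boldsymbol{L}=\boldsymbol{U}\,\mathrm{diag}(\lambda_1,\dots,\lambda_N)\,\boldsymbol{U}^\top$, $\boldsymbol{U}^\top\boldsymbol{U}=\boldsymbol{I}$, $\lambda_i\ge0$, largest eigenvalue $\lambda_{\max}>0$. For fixed $\delta>0$, $\boldsymbol{L}_\delta=\boldsymbol{L}/\lambda_{\max}+\delta\boldsymbol{I}=\boldsymbol{U}\,\mathrm{diag}(\mu_1,\dots,\mu_N)\,\boldsymbol{U}^\top$ with $\mu_i=\lambda_i/\lambda_{\max}+\delta>0$. The Gaussian reference is $\mathcal{N}(\boldsymbol{0},\boldsymbol{\Sigma}_{\mathrm{ref}})$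 with $\boldsymbol{\Sigma}_{\mathrm{ref}}=\boldsymbol{U}\,\mathrm{diag}(v_1,\dots,v_N)\,\boldsymbol{U}^\top$. The propagated reference at noise level $q$ is the law of $\boldsymbol{A}(\mathbf{x}_0+q\boldsymbol{\epsilon})$, where $\mathbf{x}_0\sim\mathcal{N}(\boldsymbol{0},\boldsymbol{\Sigma}_{\mathrm{ref}})$ and $\boldsymbol{\epsilon}\sim\mathcal{N}(\boldsymbol{0},\boldsymbol{I})$ are independent and $\boldsymbol{A}=\big(\boldsymbol{I}+\frac{q^2}{\sigma^2}\boldsymbol{L}_\delta\big)^{-1/2}$; it is the centered Gaussian with mode variances $\gamma_i$. In the application $q=q(t_{\max})=\kappa t_{\max}$. Convergence of the Gaussian laws is convergence in distribution (equivalently here, convergence of covariance matrices). *)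

theory Defs
  imports "HOL-Probability.Probability"
begin

definition diag_matrix :: "('n::finite \<Rightarrow> real) \<Rightarrow> real^'n^'n" where
  "diag_matrix d = (\<chi> i j. if i = j then d i else 0)"

definition weighted_graph :: "real^'n^'n \<Rightarrow> bool" where
  "weighted_graph W \<longleftrightarrow> transpose W = W \<and> (\<forall>i j. 0 \<le> W $ i $ j)"

definition degree :: "real^'n^'n \<Rightarrow> 'n::finite \<Rightarrow> real" where
  "degree W i = (\<Sum>j\<in>UNIV. W $ i $ j)"

(* For positive degrees this is I - D^(-1/2) W D^(-1/2). Since 1 / 0 = 0, an isolated
   node gets a zero row and column. *)
definition normalized_laplacian :: "real^'n^'n \<Rightarrow> real^'n^'n" where
  "normalized_laplacian W =
     diag_matrix (\<lambda>i. 1 / sqrt (degree W i)) ** (diag_matrix (degree W) - W)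
       ** diag_matrix (\<lambda>i. 1 / sqrt (degree W i))"

definition pos_semidef :: "real^'n^'n \<Rightarrow> bool" where
  "pos_semidef M \<longleftrightarrow> transpose M = M \<and> (\<forall>x. 0 \<le> x \<bullet> (M *v x))"

(* The principal square root; meaningful for positive semidefinite arguments only. *)
definition matrix_sqrt :: "real^'n^'n \<Rightarrow> real^'n^'n" where
  "matrix_sqrt M = (THE B. pos_semidef B \<and> B ** B = M)"

(* The centered Gaussian law with covariance S, given by its Lebesgue density;
   meaningful for symmetric positive definite S only. *)
definition gaussian :: "real^'n^'n \<Rightarrow> (real^'n) measure" where
  "gaussian S = density lborel (\<lambda>x. ennreal
     (exp (- (x \<bullet> (matrix_inv S *v x)) / 2) / sqrt ((2 * pi) ^ CARD('n) * det S)))"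

(* The law of A (x + q e) for independent x ~ N(0, S) and e ~ N(0, I), where
   A = (I + (q / sigma)^2 K)^(-1/2). *)
definition propagated_reference ::
    "real \<Rightarrow> real^'n^'n \<Rightarrow> real^'n^'n \<Rightarrow> real \<Rightarrow> (real^'n) measure" where
  "propagated_reference \<sigma> K S q =
     distr (gaussian S \<Otimes>\<^sub>M gaussian (mat 1)) borel
       (\<lambda>(x, e). matrix_inv (matrix_sqrt (mat 1 + (q\<^sup>2 / \<sigma>\<^sup>2) *\<^sub>R K)) *v (x + q *\<^sub>R e))"

(* The library's weak_conv_m only covers sequences of measures on the real line. *)
definition converges_in_distribution ::
    "('i \<Rightarrow> 'a::topological_space measure) \<Rightarrow> 'a measure \<Rightarrow> 'i filter \<Rightarrow> bool" where
  "converges_in_distribution M N F \<longleftrightarrow>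
     (\<forall>f :: 'a \<Rightarrow> real. continuous_on UNIV f \<longrightarrow> bounded (range f) \<longrightarrow>
        ((\<lambda>i. integral\<^sup>L (M i) f) \<longlongrightarrow> integral\<^sup>L N f) F)"

end

theory Submission
  imports Defs "HOL-Real_Asymp.Real_Asymp"
begin

text \<open>
  The normalized Laplacian is positive semidefinite, so all \<open>\<mu> i\<close> are positive. Conjugating by \<open>U\<close>
  diagonalises the covariances and the propagation matrix simultaneously, and Lebesgue measure is
  invariant under \<open>U\<close>; hence every Gaussian involved is the image under \<open>U\<close> of a product of
  one-dimensional centered normal laws, and the propagation acts coordinatewise as
  \<open>(x, e) \<mapsto> (x + q * e) / sqrt (1 + q\<^sup>2 / \<sigma>\<^sup>2 * \<mu> i)\<close>. This gives the variances \<open>\<gamma> q i\<close>. Realising the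
  Gaussians for all \<open>q\<close> on one probability space, as random vectors that depend continuously on their
  mode variances, reduces convergence in distribution to dominated convergence.
\<close>

section \<open>Algebra of matrices that are diagonal in a fixed orthonormal basis\<close>

abbreviation spectral :: "real^'n^'n \<Rightarrow> ('n::finite \<Rightarrow> real) \<Rightarrow> real^'n^'n" where
  "spectral U s \<equiv> U ** diag_matrix s ** transpose U"

lemma diag_matrix_mult_component:
  "(diag_matrix d ** A) $ i $ j = d i * A $ i $ j"
  "(A ** diag_matrix d) $ i $ j = A $ i $ j * d j"
  by (simp_all add: matrix_matrix_mult_def diag_matrix_def if_distrib[of "\<lambda>x. x * _"]
      if_distrib[of "\<lambda>x. _ * x"] cong: if_cong)

lemma matrix_add_rdistrib: "(A + B) ** C = A ** C + B ** (C :: 'a::semiring_1^'n^'m)"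
  by (simp add: vec_eq_iff matrix_matrix_mult_def algebra_simps sum.distrib)

lemma diag_matrix_mult: "diag_matrix a ** diag_matrix b = diag_matrix (\<lambda>i. a i * b i)"
  by (simp add: vec_eq_iff diag_matrix_mult_component) (simp add: diag_matrix_def)

lemma diag_matrix_vector_mult: "diag_matrix d *v x = (\<chi> i. d i * x $ i)"
  by (simp add: vec_eq_iff matrix_vector_mult_def diag_matrix_def if_distrib[of "\<lambda>x. x * _"]
      cong: if_cong)

lemma transpose_diag_matrix: "transpose (diag_matrix d) = diag_matrix d"
  by (auto simp: vec_eq_iff transpose_def diag_matrix_def)

lemma diag_matrix_1: "diag_matrix (\<lambda>_. 1) = mat 1"
  by (simp add: vec_eq_iff mat_def diag_matrix_def)

lemma det_diag_matrix: "det (diag_matrix d) = prod d UNIV"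
  by (subst det_diagonal) (simp_all add: diag_matrix_def)

text \<open>\<open>matrix_inv\<close> is a choice among two-sided inverses. For square matrices the
  right inverse \<open>B\<close> is two-sided, so the choice is made from a nonempty set, and
  associativity forces the chosen matrix to be \<open>B\<close>.\<close>

lemma matrix_inv_unique:
  fixes A B :: "real^'n^'n"
  assumes "A ** B = mat 1"
  shows "matrix_inv A = B"
proof -
  have BA: "B ** A = mat 1"
    using assms matrix_left_right_inverse by blast
  have "A ** matrix_inv A = mat 1"
    unfolding matrix_inv_def by (rule someI2[of _ B]) (use assms BA in auto)
  then have "B ** (A ** matrix_inv A) = B" by simp
  then show ?thesis by (simp add: matrix_mul_assoc BA)
qed

lemma transpose_spectral: "transpose (spectral U s) = spectral U s"
  by (simp add: matrix_transpose_mul transpose_diag_matrix matrix_mul_assoc)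

text \<open>The inner factor \<open>transpose U ** U\<close> cancels, so for fixed \<open>U\<close>
  these matrices multiply like their eigenvalue functions. Inverses and square roots thereby become
  operations on eigenvalues.\<close>

lemma spectral_mult:
  assumes "orthogonal_matrix U"
  shows "spectral U a ** spectral U b = spectral U (\<lambda>i. a i * b i)"
proof -
  have "spectral U a ** spectral U b
      = U ** diag_matrix a ** (transpose U ** U) ** diag_matrix b ** transpose U"
    by (simp only: matrix_mul_assoc)
  also have "transpose U ** U = mat 1"
    using assms orthogonal_matrix by blast
  also have "U ** diag_matrix a ** mat 1 ** diag_matrix b = U ** (diag_matrix a ** diag_matrix b)"
    by (simp only: matrix_mul_assoc matrix_mul_rid)
  finally show ?thesis
    by (simp only: diag_matrix_mult)
qed

lemma spectral_1:
  assumes "orthogonal_matrix U"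
  shows "spectral U (\<lambda>_. 1) = mat 1"
  using assms by (simp add: diag_matrix_1 orthogonal_matrix_def)

lemma spectral_add: "spectral U a + spectral U b = spectral U (\<lambda>i. a i + b i)"
proof -
  have "diag_matrix a + diag_matrix b = diag_matrix (\<lambda>i. a i + b i)"
    by (simp add: vec_eq_iff diag_matrix_def)
  then show ?thesis
    by (simp flip: matrix_add_ldistrib matrix_add_rdistrib)
qed

lemma spectral_scaleR: "c *\<^sub>R spectral U a = spectral U (\<lambda>i. c * a i)"
proof -
  have "diag_matrix (\<lambda>i. c * a i) = c *\<^sub>R diag_matrix a"
    by (simp add: vec_eq_iff diag_matrix_def)
  then show ?thesis
    by (simp add: matrix_scalar_ac scalar_matrix_assoc)
qed

lemma matrix_inv_spectral:
  assumes "orthogonal_matrix U" "\<And>i. a i \<noteq> 0"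
  shows "matrix_inv (spectral U a) = spectral U (\<lambda>i. inverse (a i))"
  by (rule matrix_inv_unique) (simp add: spectral_mult spectral_1 assms)

lemma det_spectral:
  assumes "orthogonal_matrix U"
  shows "det (spectral U s) = prod s UNIV"
proof -
  have "det (spectral U s) = det (U ** transpose U) * prod s UNIV"
    by (simp add: det_mul det_diag_matrix del: det_transpose)
  then show ?thesis
    using assms by (simp add: orthogonal_matrix_def)
qed

text \<open>Moving \<open>U\<close> across the inner product leaves a diagonal form in the
  coordinates \<open>transpose U *v x\<close>. This serves both the semidefiniteness arguments and
  the exponent of the Gaussian density.\<close>

lemma inner_spectral:
  "x \<bullet> (spectral U s *v x) = (\<Sum>i\<in>UNIV. s i * ((transpose U *v x) $ i)\<^sup>2)"
proof -
  have "x \<bullet> (spectral U s *v x) = (transpose U *v x) \<bullet> (diag_matrix s *v (transpose U *v x))"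
    by (simp only: dot_lmul_matrix transpose_matrix_vector flip: matrix_vector_mul_assoc)
  then show ?thesis
    by (simp add: inner_vec_def diag_matrix_vector_mult power2_eq_square algebra_simps
        del: transpose_matrix_vector)
qed

section \<open>Positive semidefiniteness and the principal square root\<close>

lemma pos_semidef_spectral:
  assumes "\<And>i. 0 \<le> s i"
  shows "pos_semidef (spectral U s)"
  unfolding pos_semidef_def inner_spectral transpose_spectral
  using assms by (auto intro!: sum_nonneg)

text \<open>The column \<open>U *v axis i 1\<close> is a unit eigenvector for \<open>s i\<close>, so
  the quadratic form takes the value \<open>s i\<close> there.\<close>

lemma pos_semidef_spectral_nonneg:
  assumes "orthogonal_matrix U" "pos_semidef (spectral U s)"
  shows "0 \<le> s i"
proof -
  have "transpose U *v (U *v axis i 1) = axis i 1"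
    using assms(1) by (simp only: matrix_vector_mul_assoc orthogonal_matrix_def) simp
  then have "(U *v axis i 1) \<bullet> (spectral U s *v (U *v axis i 1)) = s i"
    unfolding inner_spectral by (simp add: axis_def if_distrib[of "\<lambda>x. _ * x"]
        if_distrib[of "\<lambda>x. x^2"] cong: if_cong)
  then show ?thesis
    using assms(2) unfolding pos_semidef_def by metis
qed

text \<open>The form at \<open>x\<close> is the form of \<open>A\<close> at \<open>B *v x\<close>.
  It is applied with an orthogonal \<open>B\<close> for the square root and with a diagonal
  \<open>B\<close> for the Laplacian.\<close>

lemma pos_semidef_congruence:
  assumes "pos_semidef A"
  shows "pos_semidef (transpose B ** A ** B)"
proof -
  have "x \<bullet> ((transpose B ** A ** B) *v x) = (B *v x) \<bullet> (A *v (B *v x))" for x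
    by (simp flip: matrix_vector_mul_assoc)
      (metis dot_lmul_matrix inner_commute)
  with assms show ?thesis
    by (simp add: pos_semidef_def matrix_transpose_mul matrix_mul_assoc)
qed

text \<open>A positive semidefinite root \<open>C\<close> of a diagonal matrix commutes with it, hence with its
  entrywise root \<open>S\<close>; then \<open>(C - S) ** (C + S) = 0\<close> and \<open>C + S\<close> is positive definite.\<close>

lemma pos_semidef_sqrt_diag_unique:
  fixes C :: "real^'n^'n"
  assumes C: "pos_semidef C" and sq: "C ** C = diag_matrix m" and m: "\<And>i. 0 < m i"
  shows "C = diag_matrix (\<lambda>i. sqrt (m i))"
proof -
  define S where "S = diag_matrix (\<lambda>i. sqrt (m i))"
  have SS: "S ** S = diag_matrix m"
    using m by (simp add: S_def diag_matrix_mult less_imp_le)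
  have "C ** diag_matrix m = diag_matrix m ** C"
    by (metis sq matrix_mul_assoc)
  then have "C $ i $ j * m j = m i * C $ i $ j" for i j
    by (metis diag_matrix_mult_component)
  \<comment> \<open>Commuting with \<open>diag_matrix m\<close> confines the nonzero entries of
    \<open>C\<close> to index pairs with equal \<open>m\<close>, and there the square roots agree as
    well; so commutation passes to \<open>S\<close>.\<close>
  then have "C $ i $ j = 0 \<or> m i = m j" for i j
    by (metis mult.commute mult_cancel_left)
  then have "C $ i $ j * sqrt (m j) = sqrt (m i) * C $ i $ j" for i j
    by (metis mult.commute mult_zero_left)
  then have comm: "C ** S = S ** C"
    unfolding S_def vec_eq_iff diag_matrix_mult_component by blast
  have prod0: "(C - S) ** (C + S) = 0"
  proof -
    have "(C - S) ** (C + S) + S ** (C + S) = C ** (C + S)"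
      by (simp flip: matrix_add_rdistrib)
    then show ?thesis
      by (simp add: matrix_add_ldistrib comm sq SS)
  qed
  have "x = 0" if x: "(C + S) *v x = 0" for x
  proof -
    have "0 \<le> x \<bullet> (C *v x)"
      using C by (simp add: pos_semidef_def)
    moreover have "x \<bullet> ((C + S) *v x) = x \<bullet> (C *v x) + x \<bullet> (S *v x)"
      by (simp add: matrix_vector_mult_add_rdistrib inner_add_right)
    moreover have Sx: "x \<bullet> (S *v x) = (\<Sum>i\<in>UNIV. sqrt (m i) * (x $ i)\<^sup>2)"
      by (simp add: S_def inner_vec_def diag_matrix_vector_mult power2_eq_square algebra_simps)
    ultimately have "(\<Sum>i\<in>UNIV. sqrt (m i) * (x $ i)\<^sup>2) \<le> 0"
      using x by simp
    moreover have "0 \<le> sqrt (m i) * (x $ i)\<^sup>2" for i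
      using m[of i] by simp
    ultimately have "sqrt (m i) * (x $ i)\<^sup>2 = 0" for i
      by (metis (mono_tags, lifting) UNIV_I finite sum_nonneg_eq_0_iff sum_nonneg order_antisym)
    then show "x = 0"
      using m by (simp add: vec_eq_iff) (metis less_irrefl)
  qed
  then obtain B where "B ** (C + S) = mat 1"
    using matrix_left_invertible_ker by blast
  then have "(C + S) ** B = mat 1"
    using matrix_left_right_inverse by blast
  then have "C - S = (C - S) ** (C + S) ** B"
    by (simp add: matrix_mul_assoc[symmetric])
  then have "C - S = 0"
    by (simp add: prod0)
  then show ?thesis by (simp add: S_def)
qed

text \<open>The definite description needs existence and uniqueness. For uniqueness, a root
  \<open>B\<close> is conjugated by \<open>U\<close> into a positive semidefinite root of
  \<open>diag_matrix m\<close>, which the diagonal case determines; conjugating back recovers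
  \<open>B\<close>.\<close>

lemma matrix_sqrt_spectral:
  assumes U: "orthogonal_matrix U" and m: "\<And>i. 0 < m i"
  shows "matrix_sqrt (spectral U m) = spectral U (\<lambda>i. sqrt (m i))"
  unfolding matrix_sqrt_def
proof (rule the_equality)
  show "pos_semidef (spectral U (\<lambda>i. sqrt (m i))) \<and>
    spectral U (\<lambda>i. sqrt (m i)) ** spectral U (\<lambda>i. sqrt (m i)) = spectral U m"
    using m by (auto simp: spectral_mult[OF U] less_imp_le intro: pos_semidef_spectral)
next
  fix B assume B: "pos_semidef B \<and> B ** B = spectral U m"
  have UU: "transpose U ** U = mat 1" "U ** transpose U = mat 1"
    using U by (auto simp: orthogonal_matrix_def)
  let ?C = "transpose U ** B ** U"
  have "?C ** ?C = transpose U ** B ** (U ** transpose U) ** B ** U"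
    by (simp only: matrix_mul_assoc)
  also have "\<dots> = transpose U ** (B ** B) ** U"
    by (simp only: UU matrix_mul_rid matrix_mul_assoc)
  also have "\<dots> = (transpose U ** U) ** diag_matrix m ** (transpose U ** U)"
    using B by (simp only: matrix_mul_assoc)
  finally have "?C ** ?C = diag_matrix m"
    by (simp add: UU)
  then have "?C = diag_matrix (\<lambda>i. sqrt (m i))"
    using B m by (intro pos_semidef_sqrt_diag_unique pos_semidef_congruence) auto
  then have "spectral U (\<lambda>i. sqrt (m i)) = U ** ?C ** transpose U"
    by simp
  also have "\<dots> = (U ** transpose U) ** B ** (U ** transpose U)"
    by (simp only: matrix_mul_assoc)
  finally have "spectral U (\<lambda>i. sqrt (m i)) = (U ** transpose U) ** B ** (U ** transpose U)" .
  then show "B = spectral U (\<lambda>i. sqrt (m i))"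
    by (simp add: UU)
qed

section \<open>Positive semidefiniteness of the normalized Laplacian\<close>

lemma pos_semidef_degree_minus_weights:
  assumes "weighted_graph W"
  shows "pos_semidef (diag_matrix (degree W) - W)"
proof -
  have sym: "W $ i $ j = W $ j $ i" and nonneg: "0 \<le> W $ i $ j" for i j
    using assms unfolding weighted_graph_def by (metis transpose_def vec_lambda_beta, simp)
  have "0 \<le> x \<bullet> ((diag_matrix (degree W) - W) *v x)" for x
  proof -
    \<comment> \<open>This Dirichlet energy is twice the quadratic form of the matrix: expanding the
      square gives two degree sums and a mixed term.\<close>
    have "0 \<le> (\<Sum>i\<in>UNIV. \<Sum>j\<in>UNIV. W $ i $ j * (x $ i - x $ j)\<^sup>2)"
      by (intro sum_nonneg mult_nonneg_nonneg nonneg) auto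
    also have "\<dots> = (\<Sum>i\<in>UNIV. \<Sum>j\<in>UNIV. W $ i $ j * (x $ i)\<^sup>2)
        + (\<Sum>i\<in>UNIV. \<Sum>j\<in>UNIV. W $ i $ j * (x $ j)\<^sup>2)
        - 2 * (\<Sum>i\<in>UNIV. \<Sum>j\<in>UNIV. W $ i $ j * x $ i * x $ j)"
      by (simp add: sum_distrib_left sum.distrib[symmetric] sum_subtractf[symmetric]
          power2_eq_square algebra_simps)
    \<comment> \<open>Exchanging the two indices and using the symmetry of \<open>W\<close>
      identifies the two square sums.\<close>
    also have "(\<Sum>i\<in>UNIV. \<Sum>j\<in>UNIV. W $ i $ j * (x $ j)\<^sup>2)
        = (\<Sum>i\<in>UNIV. \<Sum>j\<in>UNIV. W $ i $ j * (x $ i)\<^sup>2)"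
      by (subst sum.swap) (simp add: sym)
    finally have "0 \<le> (\<Sum>i\<in>UNIV. degree W i * (x $ i)\<^sup>2)
        - (\<Sum>i\<in>UNIV. \<Sum>j\<in>UNIV. W $ i $ j * x $ i * x $ j)"
      by (simp add: degree_def sum_distrib_right)
    also have "\<dots> = x \<bullet> ((diag_matrix (degree W) - W) *v x)"
      unfolding matrix_vector_mult_diff_rdistrib inner_diff_right diag_matrix_vector_mult
      by (simp add: inner_vec_def matrix_vector_mult_def sum_distrib_left power2_eq_square mult_ac)
    finally show ?thesis .
  qed
  moreover have "transpose (diag_matrix (degree W) - W) = diag_matrix (degree W) - W"
    using sym by (auto simp: vec_eq_iff transpose_def diag_matrix_def)
  ultimately show ?thesis
    by (simp add: pos_semidef_def)
qed

text \<open>The scaling by inverse root degrees is a congruence with a symmetric matrix. An isolated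
  node gets the factor \<open>1 / sqrt 0 = 0\<close>, for which the congruence is equally
  valid.\<close>

lemma pos_semidef_normalized_laplacian:
  assumes "weighted_graph W"
  shows "pos_semidef (normalized_laplacian W)"
  using pos_semidef_congruence[OF pos_semidef_degree_minus_weights[OF assms],
      of "diag_matrix (\<lambda>i. 1 / sqrt (degree W i))"]
  by (simp add: normalized_laplacian_def transpose_diag_matrix)

section \<open>Invariance of Lebesgue measure under orthogonal maps\<close>

text \<open>Compare the measures of \<open>A\<close> and its preimage by a Fubini argument against the unit ball, which
  \<open>f\<close> preserves. The library's change of variables theorems require a well-ordered index type.\<close>

lemma distr_lborel_orthogonal_transformation:
  fixes f :: "'a::euclidean_space \<Rightarrow> 'a"
  assumes f: "orthogonal_transformation f"
  shows "distr lborel borel f = lborel"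
proof (rule measure_eqI)
  have lin: "linear f"
    using f by (rule orthogonal_transformation_linear)
  then have cont: "continuous_on UNIV f"
    by (simp add: linear_continuous_on linear_linear)
  have [measurable]: "f \<in> borel_measurable borel"
    using cont by (rule borel_measurable_continuous_onI)
  have nf: "norm (f x) = norm x" for x
    using f by (rule orthogonal_transformation_norm)
  obtain g where g: "\<And>x. f (g x) = x"
    using orthogonal_transformation_surj[OF f] by (metis surj_def)
  fix A assume "A \<in> sets (distr lborel borel f)"
  then have [measurable]: "A \<in> sets borel" by simp
  let ?B = "ball 0 1 :: 'a set"
  have [measurable]: "?B \<in> sets borel" by simp
  have tr: "(\<integral>\<^sup>+x. h (c + x) \<partial>lborel) = (\<integral>\<^sup>+x. h x \<partial>lborel)"
    if [measurable]: "h \<in> borel_measurable borel" for h :: "'a \<Rightarrow> ennreal" and c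
    by (subst (2) lborel_affine[of 1 c]) (simp_all add: nn_integral_density nn_integral_distr)
  have reflect: "(\<integral>\<^sup>+x. h (c - x) \<partial>lborel) = (\<integral>\<^sup>+x. h x \<partial>lborel)"
    if [measurable]: "h \<in> borel_measurable borel" for h :: "'a \<Rightarrow> ennreal" and c
    by (subst (2) lborel_affine[of "-1" c]) (simp_all add: nn_integral_density nn_integral_distr)
  \<comment> \<open>By linearity \<open>f x + y = f (g y + x)\<close>, and \<open>f\<close>
    preserves norms; so a condition on a shift by \<open>f x\<close> becomes one on a shift by
    \<open>g y\<close>.\<close>
  have ball: "indicator ?B (f x + y) = (indicator ?B (g y + x) :: ennreal)" for x y
  proof -
    have "norm (f x + y) = norm (g y + x)"
      using nf[of "g y + x"] by (simp add: linear_add[OF lin] g add.commute)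
    then show ?thesis by (simp add: indicator_def)
  qed
  \<comment> \<open>The chain shifts \<open>y\<close> by \<open>f x\<close>, swaps the integrals,
    shifts \<open>x\<close> by \<open>g y\<close> and swaps back. What remains inside is the
    integral over \<open>y\<close> of the indicator of \<open>A\<close> at \<open>f x - y\<close>,
    which is the measure of \<open>A\<close> by reflection.\<close>
  have "emeasure (distr lborel borel f) A * emeasure lborel ?B
      = (\<integral>\<^sup>+x. indicator A (f x) * (\<integral>\<^sup>+y. indicator ?B y \<partial>lborel) \<partial>lborel)"
  proof -
    have "(\<integral>\<^sup>+x. indicator A (f x) \<partial>lborel) = emeasure (distr lborel borel f) A"
      using nn_integral_distr[of f lborel borel "indicator A"] by simp
    then show ?thesis by (simp add: nn_integral_multc)
  qed
  also have "\<dots> = (\<integral>\<^sup>+x. indicator A (f x) * (\<integral>\<^sup>+y. indicator ?B (f x + y) \<partial>lborel) \<partial>lborel)"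
    by (subst tr[of "indicator ?B"]) simp_all
  also have "\<dots> = (\<integral>\<^sup>+x. (\<integral>\<^sup>+y. indicator A (f x) * indicator ?B (f x + y) \<partial>lborel) \<partial>lborel)"
    by (simp add: nn_integral_cmult)
  also have "\<dots> = (\<integral>\<^sup>+y. (\<integral>\<^sup>+x. indicator A (f x) * indicator ?B (f x + y) \<partial>lborel) \<partial>lborel)"
    by (rule lborel_pair.Fubini') measurable
  also have "\<dots> = (\<integral>\<^sup>+y. (\<integral>\<^sup>+x. indicator A (f (g y + x) - y) * indicator ?B (g y + x) \<partial>lborel) \<partial>lborel)"
    by (simp add: ball linear_add[OF lin] g)
  also have "\<dots> = (\<integral>\<^sup>+y. (\<integral>\<^sup>+x. indicator A (f x - y) * indicator ?B x \<partial>lborel) \<partial>lborel)"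
    by (subst tr[of "\<lambda>x. indicator A (f x - y) * indicator ?B x" "g y" for y]) simp_all
  also have "\<dots> = (\<integral>\<^sup>+x. (\<integral>\<^sup>+y. indicator A (f x - y) * indicator ?B x \<partial>lborel) \<partial>lborel)"
    by (rule lborel_pair.Fubini') measurable
  also have "\<dots> = (\<integral>\<^sup>+x. (\<integral>\<^sup>+y. indicator A (f x - y) \<partial>lborel) * indicator ?B x \<partial>lborel)"
    by (simp add: nn_integral_multc)
  also have "\<dots> = (\<integral>\<^sup>+x. emeasure lborel A * indicator ?B x \<partial>lborel)"
    by (subst reflect[of "indicator A" "f x" for x]) simp_all
  also have "\<dots> = emeasure lborel A * emeasure lborel ?B"
    by (simp add: nn_integral_cmult)
  finally have eq: "emeasure lborel ?B * emeasure (distr lborel borel f) A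
      = emeasure lborel ?B * emeasure lborel A"
    by (simp add: mult.commute)
  have "emeasure lborel ?B \<noteq> 0"
    using content_ball_pos[of 1 "0 :: 'a"] by (auto simp: measure_def)
  moreover have "emeasure lborel ?B \<noteq> top"
    using emeasure_bounded_finite[of ?B] by (simp add: less_top)
  ultimately show "emeasure (distr lborel borel f) A = emeasure lborel A"
    using eq by (simp add: ennreal_mult_cancel_left)
qed simp

section \<open>Lebesgue measure and product measures in coordinates\<close>

lemma borel_measurable_vec_lambda:
  fixes g :: "'a \<Rightarrow> 'n::finite \<Rightarrow> real"
  assumes "\<And>i. (\<lambda>x. g x i) \<in> borel_measurable M"
  shows "(\<lambda>x. vec_lambda (g x)) \<in> borel_measurable M"
  by (subst borel_measurable_euclidean_space) (use assms in \<open>auto simp: Basis_vec_def inner_axis\<close>)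

lemma borel_measurable_matrix_vector_mult:
  fixes A :: "real^'n^'m"
  assumes "f \<in> borel_measurable M"
  shows "(\<lambda>x. A *v f x) \<in> borel_measurable M"
  by (rule measurable_compose[OF assms])
    (intro borel_measurable_continuous_onI linear_continuous_on matrix_vector_mul_bounded_linear)

text \<open>Lebesgue measure is determined by its values on boxes, whose preimages under
  \<open>vec_lambda\<close> are products of intervals. In this form a density that factors over the
  coordinates yields a product measure.\<close>

lemma lborel_eq_distr_PiM_vec:
  "distr (\<Pi>\<^sub>M i\<in>UNIV. lborel) borel vec_lambda = (lborel :: (real^'n) measure)"
proof (rule lborel_eqI[symmetric])
  interpret finite_product_sigma_finite "\<lambda>_. lborel :: real measure" "UNIV :: 'n set"
    by standard simp
  have [measurable]: "vec_lambda \<in> (\<Pi>\<^sub>M i\<in>UNIV. lborel) \<rightarrow>\<^sub>M (borel :: (real^'n) measure)"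
    by (rule borel_measurable_vec_lambda) simp
  fix l u :: "real^'n" assume lu: "\<And>b. b \<in> Basis \<Longrightarrow> l \<bullet> b \<le> u \<bullet> b"
  have le: "l $ i \<le> u $ i" for i
    using lu[of "axis i 1"] by (auto simp: Basis_vec_def inner_axis)
  have "emeasure (distr (\<Pi>\<^sub>M i\<in>UNIV. lborel) borel vec_lambda) (box l u)
      = emeasure (\<Pi>\<^sub>M i\<in>UNIV. lborel) (\<Pi>\<^sub>E i\<in>UNIV. {l $ i <..< u $ i})"
    by (subst emeasure_distr) (auto simp: space_PiM mem_box_cart PiE_iff intro!: arg_cong2[where f=emeasure])
  also have "\<dots> = (\<Prod>i\<in>UNIV. emeasure lborel {l $ i <..< u $ i})"
    by (rule measure_times) auto
  also have "\<dots> = ennreal (\<Prod>i\<in>UNIV. (u - l) $ i)"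
    using le by (simp add: prod_ennreal)
  also have "(\<Prod>i\<in>UNIV. (u - l) $ i) = (\<Prod>b\<in>Basis. (u - l) \<bullet> b)"
    by (simp add: Basis_vec_def cart_eq_inner_axis axis_eq_axis prod.UNION_disjoint)
  finally show "emeasure (distr (\<Pi>\<^sub>M i\<in>UNIV. lborel) borel vec_lambda) (box l u)
      = ennreal (\<Prod>b\<in>Basis. (u - l) \<bullet> b)" .
qed simp

text \<open>A product measure is determined by rectangles, whose indicators factor over the
  coordinates, so the integral of the product splits. Sigma-finiteness of the densities is assumed
  separately, since an arbitrary \<open>f i\<close> may take infinite values.\<close>

lemma PiM_density:
  assumes fin: "finite I"
    and M: "\<And>i. sigma_finite_measure (M i)" "\<And>i. sigma_finite_measure (density (M i) (f i))"
    and [measurable]: "\<And>i. f i \<in> borel_measurable (M i)"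
  shows "density (PiM I M) (\<lambda>x. \<Prod>i\<in>I. f i (x i)) = (\<Pi>\<^sub>M i\<in>I. density (M i) (f i))"
proof -
  interpret M: product_sigma_finite M
    using M(1) by (simp add: product_sigma_finite_def)
  interpret N: product_sigma_finite "\<lambda>i. density (M i) (f i)"
    using M(2) by (simp add: product_sigma_finite_def)
  show ?thesis
  proof (rule N.PiM_eqI[OF fin])
    show "sets (density (PiM I M) (\<lambda>x. \<Prod>i\<in>I. f i (x i))) = sets (\<Pi>\<^sub>M i\<in>I. density (M i) (f i))"
      by (simp cong: sets_PiM_cong)
    fix A assume "\<And>i. i \<in> I \<Longrightarrow> A i \<in> sets (density (M i) (f i))"
    then have A[measurable]: "A i \<in> sets (M i)" if "i \<in> I" for i
      using that by simp
    have [measurable]: "Pi\<^sub>E I A \<in> sets (PiM I M)"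
      using fin A by (rule sets_PiM_I_finite)
    have "emeasure (density (PiM I M) (\<lambda>x. \<Prod>i\<in>I. f i (x i))) (Pi\<^sub>E I A)
        = (\<integral>\<^sup>+x. (\<Prod>i\<in>I. f i (x i)) * indicator (Pi\<^sub>E I A) x \<partial>PiM I M)"
      by (rule emeasure_density) measurable
    also have "\<dots> = (\<integral>\<^sup>+x. (\<Prod>i\<in>I. f i (x i) * indicator (A i) (x i)) \<partial>PiM I M)"
    proof (rule nn_integral_cong)
      fix x assume "x \<in> space (PiM I M)"
      then have "indicator (Pi\<^sub>E I A) x = (\<Prod>i\<in>I. indicator (A i) (x i) :: ennreal)"
        using fin by (auto simp: space_PiM indicator_def PiE_iff)
      then show "(\<Prod>i\<in>I. f i (x i)) * indicator (Pi\<^sub>E I A) x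
          = (\<Prod>i\<in>I. f i (x i) * indicator (A i) (x i))"
        by (simp add: prod.distrib)
    qed
    also have "\<dots> = (\<Prod>i\<in>I. \<integral>\<^sup>+x. f i x * indicator (A i) x \<partial>M i)"
      by (rule M.product_nn_integral_prod[OF fin]) measurable
    also have "\<dots> = (\<Prod>i\<in>I. emeasure (density (M i) (f i)) (A i))"
      by (intro prod.cong) (auto simp: emeasure_density)
    finally show "emeasure (density (PiM I M) (\<lambda>x. \<Prod>i\<in>I. f i (x i))) (Pi\<^sub>E I A)
        = (\<Prod>i\<in>I. emeasure (density (M i) (f i)) (A i))" .
  qed
qed

text \<open>Maps acting on each pair of coordinates keep the coordinates independent. On a
  rectangle, the preimage has as its section at \<open>f\<close> the product of the sections of the
  sets \<open>B i\<close> at \<open>f i\<close>, so the iterated integral factors.\<close>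

lemma distr_PiM_pair:
  fixes M N K :: "'i \<Rightarrow> _"
  assumes fin: "finite I"
    and M: "\<And>i. prob_space (M i)" and N: "\<And>i. prob_space (N i)"
    and h: "\<And>i. (\<lambda>(x, y). h i x y) \<in> M i \<Otimes>\<^sub>M N i \<rightarrow>\<^sub>M K i"
  shows "distr (PiM I M \<Otimes>\<^sub>M PiM I N) (PiM I K) (\<lambda>(f, g). \<lambda>i\<in>I. h i (f i) (g i))
    = (\<Pi>\<^sub>M i\<in>I. distr (M i \<Otimes>\<^sub>M N i) (K i) (\<lambda>(x, y). h i x y))"
proof -
  interpret M: product_prob_space M I by (intro product_prob_spaceI M)
  interpret N: product_prob_space N I by (intro product_prob_spaceI N)
  interpret pr: pair_prob_space "M i" "N i" for i
    by (simp add: pair_prob_space_def pair_sigma_finite_def M N prob_space_imp_sigma_finite)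
  interpret K: product_prob_space "\<lambda>i. distr (M i \<Otimes>\<^sub>M N i) (K i) (\<lambda>(x, y). h i x y)" I
    by (intro product_prob_spaceI pr.prob_space_distr h)
  have h'[measurable]: "(\<lambda>p. h i (fst p) (snd p)) \<in> M i \<Otimes>\<^sub>M N i \<rightarrow>\<^sub>M K i" for i
    using h[of i] by (simp add: case_prod_beta')
  have H[measurable]: "(\<lambda>(f, g). \<lambda>i\<in>I. h i (f i) (g i)) \<in> PiM I M \<Otimes>\<^sub>M PiM I N \<rightarrow>\<^sub>M PiM I K"
    unfolding case_prod_beta'
  proof (rule measurable_restrict)
    fix i assume "i \<in> I"
    then have "(\<lambda>p. (fst p i, snd p i)) \<in> PiM I M \<Otimes>\<^sub>M PiM I N \<rightarrow>\<^sub>M M i \<Otimes>\<^sub>M N i"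
      by measurable
    from measurable_compose[OF this h'[of i]]
    show "(\<lambda>p. h i (fst p i) (snd p i)) \<in> PiM I M \<Otimes>\<^sub>M PiM I N \<rightarrow>\<^sub>M K i" by simp
  qed
  show ?thesis
  proof (rule K.PiM_eqI[OF fin])
    fix A assume "\<And>i. i \<in> I \<Longrightarrow> A i \<in> sets (distr (M i \<Otimes>\<^sub>M N i) (K i) (\<lambda>(x, y). h i x y))"
    then have A[measurable]: "A i \<in> sets (K i)" if "i \<in> I" for i
      using that by simp
    define B where "B i = {p \<in> space (M i \<Otimes>\<^sub>M N i). h i (fst p) (snd p) \<in> A i}" for i
    have B[measurable]: "B i \<in> sets (M i \<Otimes>\<^sub>M N i)" if [simp]: "i \<in> I" for i
      unfolding B_def by measurable
    have AK: "Pi\<^sub>E I A \<in> sets (PiM I K)"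
      using fin A by (rule sets_PiM_I_finite)
    let ?D = "(\<lambda>(f, g). \<lambda>i\<in>I. h i (f i) (g i)) -` Pi\<^sub>E I A \<inter> space (PiM I M \<Otimes>\<^sub>M PiM I N)"
    have D: "?D \<in> sets (PiM I M \<Otimes>\<^sub>M PiM I N)"
      using H AK by (rule measurable_sets)
    have "emeasure (distr (PiM I M \<Otimes>\<^sub>M PiM I N) (PiM I K) (\<lambda>(f, g). \<lambda>i\<in>I. h i (f i) (g i))) (Pi\<^sub>E I A)
      = emeasure (PiM I M \<Otimes>\<^sub>M PiM I N) ?D"
      using H AK by (rule emeasure_distr)
    also have "\<dots> = (\<integral>\<^sup>+f. emeasure (PiM I N) (Pair f -` ?D) \<partial>PiM I M)"
      using D by (intro sigma_finite_measure.emeasure_pair_measure_alt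
          prob_space_imp_sigma_finite prob_space_PiM N)
    also have "\<dots> = (\<integral>\<^sup>+f. (\<Prod>i\<in>I. emeasure (N i) (Pair (f i) -` B i)) \<partial>PiM I M)"
    proof (rule nn_integral_cong)
      fix f assume f: "f \<in> space (PiM I M)"
      have "Pair f -` ?D = (\<Pi>\<^sub>E i\<in>I. Pair (f i) -` B i)"
        using f by (auto simp: B_def space_pair_measure space_PiM PiE_iff)
      also have "emeasure (PiM I N) \<dots> = (\<Prod>i\<in>I. emeasure (N i) (Pair (f i) -` B i))"
        using fin by (intro N.emeasure_PiM sets_Pair1[OF B])
      finally show "emeasure (PiM I N) (Pair f -` ?D) = (\<Prod>i\<in>I. emeasure (N i) (Pair (f i) -` B i))" .
    qed
    also have "\<dots> = (\<Prod>i\<in>I. \<integral>\<^sup>+x. emeasure (N i) (Pair x -` B i) \<partial>M i)"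
      by (rule M.product_nn_integral_prod[OF fin]) (intro sigma_finite_measure.measurable_emeasure_Pair prob_space_imp_sigma_finite N B)
    also have "\<dots> = (\<Prod>i\<in>I. emeasure (distr (M i \<Otimes>\<^sub>M N i) (K i) (\<lambda>(x, y). h i x y)) (A i))"
    proof (intro prod.cong refl)
      fix i assume i: "i \<in> I"
      have "emeasure (distr (M i \<Otimes>\<^sub>M N i) (K i) (\<lambda>(x, y). h i x y)) (A i) = emeasure (M i \<Otimes>\<^sub>M N i) (B i)"
        using i A h' unfolding B_def case_prod_beta'
        by (subst emeasure_distr) (auto intro!: arg_cong2[where f=emeasure])
      also have "\<dots> = (\<integral>\<^sup>+x. emeasure (N i) (Pair x -` B i) \<partial>M i)"
        using i by (intro sigma_finite_measure.emeasure_pair_measure_alt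
            prob_space_imp_sigma_finite N B)
      finally show "(\<integral>\<^sup>+x. emeasure (N i) (Pair x -` B i) \<partial>M i)
        = emeasure (distr (M i \<Otimes>\<^sub>M N i) (K i) (\<lambda>(x, y). h i x y)) (A i)" ..
    qed
    finally show "emeasure (distr (PiM I M \<Otimes>\<^sub>M PiM I N) (PiM I K) (\<lambda>(f, g). \<lambda>i\<in>I. h i (f i) (g i))) (Pi\<^sub>E I A)
      = (\<Prod>i\<in>I. emeasure (distr (M i \<Otimes>\<^sub>M N i) (K i) (\<lambda>(x, y). h i x y)) (A i))" .
  qed (simp cong: sets_PiM_cong)
qed

section \<open>Gaussian laws as images of products of normal laws\<close>

abbreviation normal_law :: "real \<Rightarrow> real measure" where
  "normal_law s \<equiv> density lborel (normal_density 0 (sqrt s))"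

lemma prob_space_normal_law: "0 < s \<Longrightarrow> prob_space (normal_law s)"
  by (simp add: prob_space_normal_density)

lemma borel_measurable_PiM_normal_law:
  "(\<lambda>f. f i) \<in> borel_measurable (\<Pi>\<^sub>M i\<in>UNIV. normal_law (s i))"
  using measurable_component_singleton[of i UNIV "\<lambda>i. normal_law (s i)"] by simp

text \<open>The projections of the product law are independent normal variables, so their scaled sum
  is normal and the variances add. Nonzero \<open>a\<close> and \<open>b\<close> keep both summands
  nondegenerate, so that each has a normal density.\<close>

lemma distr_normal_law_add:
  assumes s: "0 < s" "0 < t" and ab: "a \<noteq> 0" "b \<noteq> 0"
  shows "distr (normal_law s \<Otimes>\<^sub>M normal_law t) borel (\<lambda>(x, y). a * x + b * y)
    = normal_law (a\<^sup>2 * s + b\<^sup>2 * t)"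
proof -
  interpret S: prob_space "normal_law s" using s by (intro prob_space_normal_law)
  interpret T: prob_space "normal_law t" using s by (intro prob_space_normal_law)
  interpret P: pair_prob_space "normal_law s" "normal_law t" ..
  have fst: "distr (normal_law s \<Otimes>\<^sub>M normal_law t) lborel fst = normal_law s"
    using T.distr_pair_fst[of "normal_law s"] by (simp cong: distr_cong)
  have "distr (normal_law t \<Otimes>\<^sub>M normal_law s) borel fst = normal_law t"
    using S.distr_pair_fst[of "normal_law t"] by (simp cong: distr_cong)
  then have snd: "distr (normal_law s \<Otimes>\<^sub>M normal_law t) lborel snd = normal_law t"
    by (subst P.distr_pair_swap) (simp add: distr_distr o_def case_prod_beta' cong: distr_cong)
  have X: "distributed (normal_law s \<Otimes>\<^sub>M normal_law t) lborel fst (normal_density 0 (sqrt s))"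
    by (simp add: distributed_def fst)
  have Y: "distributed (normal_law s \<Otimes>\<^sub>M normal_law t) lborel snd (normal_density 0 (sqrt t))"
    by (simp add: distributed_def snd)
  have "distr (normal_law s \<Otimes>\<^sub>M normal_law t) borel fst = normal_law s"
    "distr (normal_law s \<Otimes>\<^sub>M normal_law t) borel snd = normal_law t"
    using fst snd by (simp_all cong: distr_cong)
  \<comment> \<open>The joint law of the two projections is the product of their laws, which is
    independence.\<close>
  moreover have "distr (normal_law s \<Otimes>\<^sub>M normal_law t) (borel \<Otimes>\<^sub>M borel) (\<lambda>p. (fst p, snd p))
      = normal_law s \<Otimes>\<^sub>M normal_law t"
    by (simp add: distr_id2 cong: sets_pair_measure_cong)
  ultimately have "P.indep_var borel fst borel snd"
    by (simp add: P.indep_var_distribution_eq)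
  then have ind: "P.indep_var borel (\<lambda>p. a * fst p) borel (\<lambda>p. b * snd p)"
    using P.indep_var_compose[of borel fst borel snd "\<lambda>x. a * x" borel "\<lambda>y. b * y" borel]
    by (simp add: o_def)
  have "distributed (normal_law s \<Otimes>\<^sub>M normal_law t) lborel (\<lambda>p. 0 + a * fst p)
      (normal_density (0 + a * 0) (\<bar>a\<bar> * sqrt s))"
    using s ab by (intro P.normal_density_affine X) auto
  moreover have "distributed (normal_law s \<Otimes>\<^sub>M normal_law t) lborel (\<lambda>p. 0 + b * snd p)
      (normal_density (0 + b * 0) (\<bar>b\<bar> * sqrt t))"
    using s ab by (intro P.normal_density_affine Y) auto
  ultimately have "distributed (normal_law s \<Otimes>\<^sub>M normal_law t) lborel (\<lambda>p. a * fst p + b * snd p)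
      (normal_density (0 + 0) (sqrt ((\<bar>a\<bar> * sqrt s)\<^sup>2 + (\<bar>b\<bar> * sqrt t)\<^sup>2)))"
    using s ab by (intro P.add_indep_normal[OF ind]) auto
  then show ?thesis
    using s by (simp add: distributed_def case_prod_beta' power_mult_distrib cong: distr_cong)
qed

text \<open>Lebesgue measure on vectors is the image of the product measure under
  \<open>vec_lambda\<close> followed by \<open>U\<close>, and the Gaussian density pulled back along
  this map is a product of normal densities.\<close>

lemma gaussian_spectral_eq_distr:
  fixes U :: "real^'n^'n"
  assumes U: "orthogonal_matrix U" and s: "\<And>i. 0 < s i"
  shows "gaussian (spectral U s)
    = distr (\<Pi>\<^sub>M i\<in>UNIV. normal_law (s i)) borel (\<lambda>f. U *v vec_lambda f)"
proof -
  let ?P = "\<Pi>\<^sub>M i\<in>(UNIV::'n set). (lborel :: real measure)"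
  let ?\<phi> = "\<lambda>x. ennreal (exp (- (x \<bullet> (matrix_inv (spectral U s) *v x)) / 2)
    / sqrt ((2 * pi) ^ CARD('n) * det (spectral U s)))"
  have [measurable]: "vec_lambda \<in> ?P \<rightarrow>\<^sub>M (borel :: (real^'n) measure)"
    by (rule borel_measurable_vec_lambda) simp
  have [measurable]: "(\<lambda>x. A *v x) \<in> borel_measurable borel" for A :: "real^'n^'n"
    by (rule borel_measurable_matrix_vector_mult) simp
  have "orthogonal_transformation (\<lambda>x. U *v x)"
    using U by (simp add: orthogonal_transformation_matrix)
  then have "distr (distr ?P borel vec_lambda) borel (\<lambda>x. U *v x) = lborel"
    by (simp add: lborel_eq_distr_PiM_vec distr_lborel_orthogonal_transformation)
  then have "lborel = distr ?P borel (\<lambda>f. U *v vec_lambda f)"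
    by (simp add: distr_distr o_def)
  then have "gaussian (spectral U s) = density (distr ?P borel (\<lambda>f. U *v vec_lambda f)) ?\<phi>"
    by (simp add: gaussian_def)
  also have "\<dots> = distr (density ?P (\<lambda>f. ?\<phi> (U *v vec_lambda f))) borel (\<lambda>f. U *v vec_lambda f)"
    by (rule density_distr) measurable
  \<comment> \<open>In these coordinates the quadratic form is the sum of
    \<open>(f i)^2 / s i\<close> and the determinant is the product of the \<open>s i\<close>, so
    exponent and normalising constant both split.\<close>
  also have "(\<lambda>f. ?\<phi> (U *v vec_lambda f))
      = (\<lambda>f. \<Prod>i\<in>UNIV. ennreal (normal_density 0 (sqrt (s i)) (f i)))"
  proof
    fix f :: "'n \<Rightarrow> real"
    have UU: "transpose U *v (U *v vec_lambda f) = vec_lambda f"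
      using U by (simp only: matrix_vector_mul_assoc orthogonal_matrix_def) simp
    have inv: "matrix_inv (spectral U s) = spectral U (\<lambda>i. inverse (s i))"
      using U s by (intro matrix_inv_spectral) (auto simp: less_imp_neq[THEN not_sym])
    have "exp (- ((U *v vec_lambda f) \<bullet> (matrix_inv (spectral U s) *v (U *v vec_lambda f))) / 2)
        = exp (\<Sum>i\<in>UNIV. - (f i)\<^sup>2 / (2 * s i))"
      unfolding inv inner_spectral UU
      by (simp add: sum_negf sum_divide_distrib field_simps)
    also have "\<dots> = (\<Prod>i\<in>UNIV. exp (- (f i)\<^sup>2 / (2 * s i)))"
      by (simp add: exp_sum)
    finally have "exp (- ((U *v vec_lambda f) \<bullet> (matrix_inv (spectral U s) *v (U *v vec_lambda f))) / 2)
        = (\<Prod>i\<in>UNIV. exp (- (f i)\<^sup>2 / (2 * s i)))" .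
    moreover have "sqrt ((2 * pi) ^ CARD('n) * det (spectral U s)) = (\<Prod>i\<in>UNIV. sqrt (2 * pi * s i))"
    proof -
      have "sqrt (\<Prod>i\<in>I. t i) = (\<Prod>i\<in>I. sqrt (t i))" for I and t :: "'n \<Rightarrow> real"
        by (induction I rule: infinite_finite_induct) (simp_all add: real_sqrt_mult)
      moreover have "(2 * pi) ^ CARD('n) * det (spectral U s) = (\<Prod>i\<in>UNIV. 2 * pi * s i)"
        by (simp add: det_spectral[OF U] prod.distrib)
      ultimately show ?thesis by simp
    qed
    ultimately show "?\<phi> (U *v vec_lambda f) = (\<Prod>i\<in>UNIV. ennreal (normal_density 0 (sqrt (s i)) (f i)))"
      using s by (simp add: prod_ennreal normal_density_def prod.distrib prod_dividef less_imp_le)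
  qed
  also have "density ?P \<dots> = (\<Pi>\<^sub>M i\<in>UNIV. normal_law (s i))"
    using s by (intro PiM_density) (auto intro: prob_space_imp_sigma_finite prob_space_normal_law
        lborel.sigma_finite_measure_axioms)
  finally show ?thesis .
qed

text \<open>Adding coordinatewise before applying \<open>U\<close> reduces the claim to sums of two
  normal variables. It yields the law of the noisy propagated signal, and also a realisation of all
  these Gaussians over one fixed pair of standard normal vectors.\<close>

lemma gaussian_spectral_eq_distr_add:
  fixes U :: "real^'n^'n"
  assumes U: "orthogonal_matrix U" and st: "\<And>i. 0 < s i" "\<And>i. 0 < t i"
    and ab: "\<And>i. a i \<noteq> 0" "\<And>i. b i \<noteq> 0"
  shows "gaussian (spectral U (\<lambda>i. (a i)\<^sup>2 * s i + (b i)\<^sup>2 * t i))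
    = distr ((\<Pi>\<^sub>M i\<in>UNIV. normal_law (s i)) \<Otimes>\<^sub>M (\<Pi>\<^sub>M i\<in>UNIV. normal_law (t i))) borel
        (\<lambda>(f, g). U *v (\<chi> i. a i * f i + b i * g i))"
proof -
  let ?P = "(\<Pi>\<^sub>M i\<in>(UNIV::'n set). normal_law (s i)) \<Otimes>\<^sub>M (\<Pi>\<^sub>M i\<in>(UNIV::'n set). normal_law (t i))"
  have [measurable]: "(\<lambda>f. U *v vec_lambda f) \<in> borel_measurable (\<Pi>\<^sub>M i\<in>UNIV. borel)"
    by (intro borel_measurable_matrix_vector_mult borel_measurable_vec_lambda) simp
  have [measurable]: "(\<lambda>(f, g). \<lambda>i\<in>UNIV. a i * f i + b i * g i) \<in> ?P \<rightarrow>\<^sub>M (\<Pi>\<^sub>M i\<in>UNIV. borel)"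
    unfolding case_prod_beta'
    by (intro measurable_restrict borel_measurable_add borel_measurable_times borel_measurable_const
        measurable_compose[OF measurable_fst] measurable_compose[OF measurable_snd]
        borel_measurable_PiM_normal_law)
  have "gaussian (spectral U (\<lambda>i. (a i)\<^sup>2 * s i + (b i)\<^sup>2 * t i))
    = distr (\<Pi>\<^sub>M i\<in>UNIV. distr (normal_law (s i) \<Otimes>\<^sub>M normal_law (t i)) borel
         (\<lambda>(x, y). a i * x + b i * y)) borel (\<lambda>f. U *v vec_lambda f)"
    using st ab by (simp add: gaussian_spectral_eq_distr[OF U] distr_normal_law_add add_pos_pos)
  also have "\<dots> = distr (distr ?P (\<Pi>\<^sub>M i\<in>UNIV. borel) (\<lambda>(f, g). \<lambda>i\<in>UNIV. a i * f i + b i * g i))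
      borel (\<lambda>f. U *v vec_lambda f)"
    using st by (subst distr_PiM_pair) (auto intro: prob_space_normal_law)
  also have "\<dots> = distr ?P borel (\<lambda>(f, g). U *v (\<chi> i. a i * f i + b i * g i))"
    by (subst distr_distr) (measurable, simp add: o_def case_prod_beta' restrict_UNIV)
  finally show ?thesis .
qed

section \<open>The law of the propagated reference\<close>

lemma propagated_reference_spectral:
  assumes U: "orthogonal_matrix U" and pos: "0 < \<sigma>" "0 < q" "\<And>i. 0 < v i" "\<And>i. 0 < \<mu> i"
  shows "propagated_reference \<sigma> (spectral U \<mu>) (spectral U v) q
    = gaussian (spectral U (\<lambda>i. \<sigma>\<^sup>2 * (v i + q\<^sup>2) / (\<sigma>\<^sup>2 + \<mu> i * q\<^sup>2)))"
proof -
  let ?V = "\<Pi>\<^sub>M i\<in>UNIV. normal_law (v i)" and ?E = "\<Pi>\<^sub>M i\<in>UNIV. normal_law 1"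
  \<comment> \<open>\<open>m\<close> holds the eigenvalues of the matrix under the square root, and
    \<open>a\<close> those of the propagation matrix itself.\<close>
  define m where "m i = 1 + q\<^sup>2 / \<sigma>\<^sup>2 * \<mu> i" for i
  define a where "a i = inverse (sqrt (m i))" for i
  have m: "0 < m i" for i
    using pos by (simp add: m_def add_pos_pos)
  have [measurable]: "(\<lambda>f. U *v vec_lambda f) \<in> borel_measurable (\<Pi>\<^sub>M i\<in>UNIV. normal_law (s i))" for s
    by (intro borel_measurable_matrix_vector_mult borel_measurable_vec_lambda
        borel_measurable_PiM_normal_law)
  have "mat 1 + (q\<^sup>2 / \<sigma>\<^sup>2) *\<^sub>R spectral U \<mu> = spectral U m"
    using spectral_add[of U "\<lambda>_. 1" "\<lambda>i. q\<^sup>2 / \<sigma>\<^sup>2 * \<mu> i"]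
    by (simp add: spectral_scaleR spectral_1[OF U] m_def[abs_def])
  then have A: "matrix_inv (matrix_sqrt (mat 1 + (q\<^sup>2 / \<sigma>\<^sup>2) *\<^sub>R spectral U \<mu>)) = spectral U a"
    using m by (simp add: matrix_sqrt_spectral[OF U] matrix_inv_spectral[OF U] a_def[abs_def]
        less_imp_neq[THEN not_sym])
  have map: "spectral U a *v (U *v vec_lambda f + q *\<^sub>R (U *v vec_lambda g))
      = U *v (\<chi> i. a i * f i + a i * q * g i)" for f g
  proof -
    have "U *v vec_lambda f + q *\<^sub>R (U *v vec_lambda g) = U *v (\<chi> i. f i + q * g i)"
      by (simp flip: matrix_vector_mult_scaleR matrix_vector_right_distrib)
        (simp add: plus_vec_def scaleR_vec_def)
    moreover have "spectral U a ** U = U ** diag_matrix a"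
      using U by (simp add: orthogonal_matrix_def flip: matrix_mul_assoc)
    ultimately have "spectral U a *v (U *v vec_lambda f + q *\<^sub>R (U *v vec_lambda g))
        = U *v (diag_matrix a *v (\<chi> i. f i + q * g i))"
      by (simp add: matrix_vector_mul_assoc)
    then show ?thesis
      by (simp add: diag_matrix_vector_mult algebra_simps)
  qed
  have V: "gaussian (spectral U v) = distr ?V borel (\<lambda>f. U *v vec_lambda f)"
    using U pos by (intro gaussian_spectral_eq_distr) auto
  \<comment> \<open>The identity is \<open>spectral U (\<lambda>_. 1)\<close>, so white noise can be
    expressed in the same basis as the reference.\<close>
  have E: "gaussian (mat 1) = distr ?E borel (\<lambda>f. U *v vec_lambda f)"
    using gaussian_spectral_eq_distr[OF U, of "\<lambda>_. 1"] by (simp add: spectral_1[OF U])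
  have "gaussian (spectral U v) \<Otimes>\<^sub>M gaussian (mat 1) = distr (?V \<Otimes>\<^sub>M ?E) (borel \<Otimes>\<^sub>M borel)
      (\<lambda>(f, g). (U *v vec_lambda f, U *v vec_lambda g))"
    unfolding V E
    by (intro pair_measure_distr prob_space_imp_sigma_finite prob_space.prob_space_distr
        prob_space_PiM prob_space_normal_law) auto
  then have "propagated_reference \<sigma> (spectral U \<mu>) (spectral U v) q
      = distr (distr (?V \<Otimes>\<^sub>M ?E) (borel \<Otimes>\<^sub>M borel) (\<lambda>(f, g). (U *v vec_lambda f, U *v vec_lambda g)))
          borel (\<lambda>(x, e). spectral U a *v (x + q *\<^sub>R e))"
    by (simp only: propagated_reference_def A)
  also have "\<dots> = distr (?V \<Otimes>\<^sub>M ?E) borel (\<lambda>(f, g). U *v (\<chi> i. a i * f i + a i * q * g i))"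
  proof (subst distr_distr)
    show "(\<lambda>(x, e). spectral U a *v (x + q *\<^sub>R e)) \<in> borel \<Otimes>\<^sub>M borel \<rightarrow>\<^sub>M borel"
      unfolding borel_prod case_prod_beta'
      by (intro borel_measurable_continuous_onI continuous_intros
          bounded_linear.continuous_on[OF matrix_vector_mul_bounded_linear])
  qed (auto simp: o_def case_prod_beta' map)
  also have "\<dots> = gaussian (spectral U (\<lambda>i. (a i)\<^sup>2 * v i + (a i * q)\<^sup>2 * 1))"
    using m pos by (intro gaussian_spectral_eq_distr_add[symmetric] U)
      (auto simp: a_def less_imp_neq[THEN not_sym])
  also have "(\<lambda>i. (a i)\<^sup>2 * v i + (a i * q)\<^sup>2 * 1) = (\<lambda>i. \<sigma>\<^sup>2 * (v i + q\<^sup>2) / (\<sigma>\<^sup>2 + \<mu> i * q\<^sup>2))"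
  proof
    fix i
    have "(a i)\<^sup>2 = \<sigma>\<^sup>2 / (\<sigma>\<^sup>2 + \<mu> i * q\<^sup>2)"
      using pos m[of i] by (simp add: a_def power_inverse less_imp_le) (simp add: m_def field_simps)
    then show "(a i)\<^sup>2 * v i + (a i * q)\<^sup>2 * 1 = \<sigma>\<^sup>2 * (v i + q\<^sup>2) / (\<sigma>\<^sup>2 + \<mu> i * q\<^sup>2)"
      by (simp add: power_mult_distrib add_divide_distrib ring_distribs)
  qed
  finally show ?thesis .
qed

section \<open>Convergence in distribution\<close>

text \<open>Writing a centered normal variable of variance \<open>s\<close> as \<open>sqrt (s / 2) * (x + y)\<close> with independent
  standard normal \<open>x\<close> and \<open>y\<close> puts all the laws on one probability space.\<close>

lemma converges_in_distribution_gaussian_spectral: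
  fixes U :: "real^'n^'n" and s :: "real \<Rightarrow> 'n \<Rightarrow> real"
  assumes U: "orthogonal_matrix U" and s: "\<And>q i. 0 < s q i" and l: "\<And>i. 0 < l i"
    and lim: "\<And>i. ((\<lambda>q. s q i) \<longlongrightarrow> l i) at_top"
  shows "converges_in_distribution (\<lambda>q. gaussian (spectral U (s q))) (gaussian (spectral U l)) at_top"
  unfolding converges_in_distribution_def
proof (intro allI impI)
  fix f :: "real^'n \<Rightarrow> real" assume f: "continuous_on UNIV f" "bounded (range f)"
  let ?E = "\<Pi>\<^sub>M i\<in>(UNIV::'n set). normal_law 1"
  define X where "X t p = U *v (\<chi> i. sqrt (t i / 2) * fst p i + sqrt (t i / 2) * snd p i)"
    for t :: "'n \<Rightarrow> real" and p
  interpret E: prob_space ?E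
    by (intro prob_space_PiM prob_space_normal_law) simp
  interpret P: pair_prob_space ?E ?E ..
  obtain B where B: "norm (f x) \<le> B" for x
    using f(2) by (auto simp: bounded_iff)
  have [measurable]: "f \<in> borel_measurable borel"
    using f(1) by (rule borel_measurable_continuous_onI)
  have X[measurable]: "X t \<in> borel_measurable (?E \<Otimes>\<^sub>M ?E)" for t
    unfolding X_def
    by (intro borel_measurable_matrix_vector_mult borel_measurable_vec_lambda borel_measurable_add
        borel_measurable_times borel_measurable_const measurable_compose[OF measurable_fst]
        measurable_compose[OF measurable_snd] borel_measurable_PiM_normal_law)
  have int: "integral\<^sup>L (gaussian (spectral U t)) f = (\<integral>p. f (X t p) \<partial>(?E \<Otimes>\<^sub>M ?E))"
    if t: "\<And>i. 0 < t i" for t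
  proof -
    have "gaussian (spectral U t) = distr (?E \<Otimes>\<^sub>M ?E) borel (X t)"
      using gaussian_spectral_eq_distr_add[OF U, of "\<lambda>_. 1" "\<lambda>_. 1"
          "\<lambda>i. sqrt (t i / 2)" "\<lambda>i. sqrt (t i / 2)"] t
      by (simp add: X_def[abs_def] case_prod_beta' less_imp_le less_imp_neq[THEN not_sym])
    then show ?thesis
      by (simp add: integral_distr)
  qed
  have "((\<lambda>q. \<integral>p. f (X (s q) p) \<partial>(?E \<Otimes>\<^sub>M ?E)) \<longlongrightarrow> (\<integral>p. f (X l p) \<partial>(?E \<Otimes>\<^sub>M ?E))) at_top"
  \<comment> \<open>The bound on \<open>f\<close> is a dominating constant, integrable because the
    space has mass one. The integrands converge at every \<open>p\<close>, as \<open>X\<close>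
    depends continuously on the variances and \<open>f\<close> is continuous.\<close>
  proof (rule integral_dominated_convergence_at_top)
    show "integrable (?E \<Otimes>\<^sub>M ?E) (\<lambda>_. B)"
      by (rule P.integrable_const)
    show "\<forall>\<^sub>F q in at_top. AE p in ?E \<Otimes>\<^sub>M ?E. norm (f (X (s q) p)) \<le> B"
      using B by simp
    have "((\<lambda>q. f (X (s q) p)) \<longlongrightarrow> f (X l p)) at_top" for p
    proof (rule continuous_on_tendsto_compose[OF f(1)])
      show "((\<lambda>q. X (s q) p) \<longlongrightarrow> X l p) at_top"
        unfolding X_def
        by (intro bounded_linear.tendsto[OF matrix_vector_mul_bounded_linear] tendsto_intros
            tendsto_vec_lambda lim) auto
    qed auto
    then show "AE p in ?E \<Otimes>\<^sub>M ?E. ((\<lambda>q. f (X (s q) p)) \<longlongrightarrow> f (X l p)) at_top"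
      by simp
  qed measurable
  then show "((\<lambda>q. integral\<^sup>L (gaussian (spectral U (s q))) f)
      \<longlongrightarrow> integral\<^sup>L (gaussian (spectral U l)) f) at_top"
    using s l by (simp add: int)
qed

theorem mainTheorem3:
  fixes W L L\<^sub>\<delta> U :: "real^'n^'n"
    and lam \<mu> v :: "'n \<Rightarrow> real"
    and \<gamma> :: "real \<Rightarrow> 'n \<Rightarrow> real"
    and lam_max \<delta> \<sigma> :: real
  assumes "weighted_graph W"
    and "L = normalized_laplacian W"
    and "orthogonal_matrix U"
    and "L = U ** diag_matrix lam ** transpose U"
    and "lam_max = Max (range lam)"
    and "lam_max > 0"
    and "\<delta> > 0"
    and "L\<^sub>\<delta> = (1 / lam_max) *\<^sub>R L + \<delta> *\<^sub>R mat 1"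
    and "\<And>i. \<mu> i = lam i / lam_max + \<delta>"
    and "\<sigma> > 0"
    and "\<And>i. v i > 0"
    and "\<And>q i. \<gamma> q i = \<sigma>\<^sup>2 * (v i + q\<^sup>2) / (\<sigma>\<^sup>2 + \<mu> i * q\<^sup>2)"
  shows "(\<forall>q>0. propagated_reference \<sigma> L\<^sub>\<delta> (U ** diag_matrix v ** transpose U) q
                = gaussian (U ** diag_matrix (\<gamma> q) ** transpose U))
       \<and> (\<forall>i. ((\<lambda>q. \<gamma> q i) \<longlongrightarrow> \<sigma>\<^sup>2 / \<mu> i) at_top)
       \<and> converges_in_distribution
            (\<lambda>q. propagated_reference \<sigma> L\<^sub>\<delta> (U ** diag_matrix v ** transpose U) q)
            (gaussian (\<sigma>\<^sup>2 *\<^sub>R matrix_inv L\<^sub>\<delta>)) at_top"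
proof -
  note U = assms(3) and sigma = \<open>\<sigma> > 0\<close> and v = assms(11) and \<gamma> = assms(12)
  \<comment> \<open>The bound comes from the graph: \<open>L\<close> is positive semidefinite, and
    the given diagonalisation exhibits each \<open>lam i\<close> as a value of its quadratic form.
    Adding \<delta> then makes every \<open>\<mu> i\<close> strictly positive.\<close>
  have "0 \<le> lam i" for i
    using pos_semidef_spectral_nonneg[OF U] pos_semidef_normalized_laplacian[OF assms(1)]
      assms(2,4) by metis
  then have \<mu>: "0 < \<mu> i" for i
    using assms(6,7) by (simp add: assms(9) add_nonneg_pos)
  have L\<delta>: "L\<^sub>\<delta> = spectral U \<mu>"
  proof -
    have "L\<^sub>\<delta> = (1 / lam_max) *\<^sub>R spectral U lam + \<delta> *\<^sub>R spectral U (\<lambda>_. 1)"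
      using assms(4,8) by (simp add: spectral_1[OF U])
    also have "\<dots> = spectral U (\<lambda>i. 1 / lam_max * lam i + \<delta> * 1)"
      by (simp only: spectral_scaleR spectral_add)
    also have "(\<lambda>i. 1 / lam_max * lam i + \<delta> * 1) = \<mu>"
      by (simp add: assms(9) fun_eq_iff)
    finally show ?thesis .
  qed
  have propagated: "propagated_reference \<sigma> L\<^sub>\<delta> (spectral U v) q = gaussian (spectral U (\<gamma> q))"
    if "q > 0" for q
    using propagated_reference_spectral[OF U sigma that, of v \<mu>] v \<mu> by (simp add: L\<delta> \<gamma>[abs_def])
  \<comment> \<open>After division by \<open>q^2\<close> the variance \<open>v i\<close> enters only
    through \<open>v i / q^2\<close>, so it disappears in the limit.\<close>
  have lim: "((\<lambda>q. \<gamma> q i) \<longlongrightarrow> \<sigma>\<^sup>2 / \<mu> i) at_top" for i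
    unfolding \<gamma> using \<mu>[of i] sigma v[of i] by (real_asymp simp: divide_inverse)
  \<comment> \<open>The convergence lemma asks for positive variances at every real
    \<open>q\<close>; this holds for \<open>q\<close> of any sign, since only \<open>q^2\<close>
    occurs.\<close>
  have \<gamma>_pos: "0 < \<gamma> q i" for q i
    using sigma v[of i] \<mu>[of i] by (auto simp: \<gamma> intro!: divide_pos_pos mult_pos_pos add_pos_nonneg)
  have "\<sigma>\<^sup>2 *\<^sub>R matrix_inv L\<^sub>\<delta> = spectral U (\<lambda>i. \<sigma>\<^sup>2 / \<mu> i)"
    using \<mu> by (simp add: L\<delta> matrix_inv_spectral[OF U] spectral_scaleR divide_inverse
        less_imp_neq[THEN not_sym])
  moreover have "converges_in_distribution (\<lambda>q. gaussian (spectral U (\<gamma> q)))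
      (gaussian (spectral U (\<lambda>i. \<sigma>\<^sup>2 / \<mu> i))) at_top"
    using sigma \<mu> by (intro converges_in_distribution_gaussian_spectral U \<gamma>_pos lim) simp
  \<comment> \<open>The propagated law was identified with a Gaussian for positive \<open>q\<close>
    only, which suffices because such \<open>q\<close> are eventually reached along
    \<open>at_top\<close>.\<close>
  ultimately have "converges_in_distribution (\<lambda>q. propagated_reference \<sigma> L\<^sub>\<delta> (spectral U v) q)
      (gaussian (\<sigma>\<^sup>2 *\<^sub>R matrix_inv L\<^sub>\<delta>)) at_top"
    unfolding converges_in_distribution_def
    by (auto elim!: Lim_transform_eventually
        intro!: eventually_mono[OF eventually_gt_at_top[of "0::real"]] simp: propagated)
  with propagated lim show ?thesis by blast
qed

end
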